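(* Let $q = 3^h$ with $h \ge 1$ an integer. Then the polar space $O^+(10,q)$ contains a Cameron--Liebler set of generators with parameter $(q^2-1)q$.
   Context: $O^+(10,q)$ denotes the finite classical polar space of rank $5$ given by the totally singular subspaces of a nondegenerate hyperbolic quadratic form on $\mathbb{F}_q^{10}$. Its points are the totally singular $1$-spaces and its generators are the totally singular $5$-spaces. Each point lies in exactly $2(q+1)(q^2+1)(q^3+1)$ generators. A set $\mathcal{L}$ of generators of $O^+(10,q)$ is called a Cameron--Liebler set of generators if its characteristic vector (in the real vector space indexed by the generators) lies in the span of the characteristic vectors of the point-pencils, where the point-pencil of a point $P$ is the set of all generators containing $P$. Its parameter is the number $x$ with $|\mathcal{L}| = 2x(q+1)(q^2+1)(q^3+1)$. (Equivalently, for every generator $\pi$, the number of elements of $\mathcal{L}$ meeting $\pi$ trivially is $(x-\chi_{\mathcal{L}}(\pi))q^{6}$, where $\chi_{\mathcal{L}}(\pi)=1$ if $\pi\in\mathcal{L}$ and $0$ otherwise.) *)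

theory Defs
  imports "HOL-Analysis.Analysis" "HOL-Library.Function_Algebras"
begin

definition polar_form :: "('a::field ^ 'n \<Rightarrow> 'a) \<Rightarrow> 'a ^ 'n \<Rightarrow> 'a ^ 'n \<Rightarrow> 'a"
  where "polar_form Q x y = Q (x + y) - Q x - Q y"

definition quadratic_form :: "('a::field ^ 'n \<Rightarrow> 'a) \<Rightarrow> bool"
  where "quadratic_form Q \<longleftrightarrow>
    (\<forall>c x. Q (c *s x) = c\<^sup>2 * Q x) \<and>
    (\<forall>y. Vector_Spaces.linear (*s) (*) (\<lambda>x. polar_form Q x y)) \<and>
    (\<forall>x. Vector_Spaces.linear (*s) (*) (\<lambda>y. polar_form Q x y))"

text \<open>The characteristic-free notion: no nonzero singular vector lies in the radical of
  the polar form.\<close>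

definition nondegenerate :: "('a::field ^ 'n \<Rightarrow> 'a) \<Rightarrow> bool"
  where "nondegenerate Q \<longleftrightarrow> (\<forall>x. Q x = 0 \<and> (\<forall>y. polar_form Q x y = 0) \<longrightarrow> x = 0)"

definition totally_singular :: "('a::field ^ 'n \<Rightarrow> 'a) \<Rightarrow> ('a ^ 'n) set \<Rightarrow> bool"
  where "totally_singular Q U \<longleftrightarrow> vec.subspace U \<and> (\<forall>u\<in>U. Q u = 0)"

text \<open>Hyperbolic means Witt index half the dimension. For nondegenerate \<open>Q\<close> on \<open>'a ^ 10\<close> a
  totally singular subspace has dimension at most 5, so it suffices
  that one of dimension 5 exists.\<close>

definition hyperbolic :: "('a::field ^ 'n \<Rightarrow> 'a) \<Rightarrow> bool"
  where "hyperbolic Q \<longleftrightarrow> (\<exists>U. totally_singular Q U \<and> 2 * vec.dim U = CARD('n))"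

definition polar_points :: "('a::field ^ 10 \<Rightarrow> 'a) \<Rightarrow> ('a ^ 10) set set"
  where "polar_points Q = {P. totally_singular Q P \<and> vec.dim P = 1}"

definition generators :: "('a::field ^ 10 \<Rightarrow> 'a) \<Rightarrow> ('a ^ 10) set set"
  where "generators Q = {G. totally_singular Q G \<and> vec.dim G = 5}"

definition point_pencil :: "('a::field ^ 10 \<Rightarrow> 'a) \<Rightarrow> ('a ^ 10) set \<Rightarrow> ('a ^ 10) set set"
  where "point_pencil Q P = {G \<in> generators Q. P \<subseteq> G}"

definition fun_scale :: "real \<Rightarrow> ('b \<Rightarrow> real) \<Rightarrow> 'b \<Rightarrow> real"
  where "fun_scale c f = (\<lambda>x. c * f x)"

interpretation fun_vs: vector_space fun_scale
  by unfold_locales (auto simp: fun_scale_def fun_eq_iff algebra_simps)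

text \<open>The real vector space indexed by the generators is represented by the real functions
  on all sets of vectors that vanish outside \<^term>\<open>generators Q\<close>; the characteristic functions
  of \<open>L\<close> and of the pencils lie in it, so the span is the same.\<close>

definition cameron_liebler :: "('a::field ^ 10 \<Rightarrow> 'a) \<Rightarrow> ('a ^ 10) set set \<Rightarrow> bool"
  where "cameron_liebler Q L \<longleftrightarrow> L \<subseteq> generators Q \<and>
    (indicator L :: ('a ^ 10) set \<Rightarrow> real)
      \<in> fun_vs.span ((\<lambda>P. indicator (point_pencil Q P)) ` polar_points Q)"

definition has_parameter :: "('a::{field,finite} ^ 10) set set \<Rightarrow> real \<Rightarrow> bool"
  where "has_parameter L x \<longleftrightarrow> (let q = real CARD('a) in
    real (card L) = 2 * x * (q + 1) * (q\<^sup>2 + 1) * (q ^ 3 + 1))"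

end

theory Submission
  imports Defs
begin

text \<open>Split the space as \<open>W \<bottom> W'\<close> with \<open>dim W = 7\<close> and \<open>dim W' = 3\<close>. For \<open>q\<close> a power of 3 the
  parabolic quadric of \<open>W\<close> carries the unitary ovoid: \<open>q\<^sup>3 + 1\<close> pairwise non-orthogonal points,
  namely the rank one Hermitian matrices \<open>v v\<^sup>*\<close> over \<open>GF(q\<^sup>2)\<close> with \<open>v\<close> isotropic, taken modulo the
  identity matrix, which has trace 0 in characteristic 3. The singular points of \<open>W'\<close> form a
  conic of \<open>q + 1\<close> pairwise non-orthogonal points. The generators on a conic point \<open>P\<close> correspond
  to the generators of an \<open>O\<^sup>+(8,q)\<close> containing the ovoid, and counting shows that
  each of those contains an ovoid point. So the \<open>q + 1\<close> pencils of the conic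
  points are pairwise disjoint and lie in the disjoint union of the \<open>q\<^sup>3 + 1\<close> pencils of the ovoid
  points; the difference is a Cameron--Liebler set with parameter
  \<open>(q\<^sup>3 + 1) - (q + 1) = (q\<^sup>2 - 1) q\<close>.\<close>

subsection \<open>Hyperbolic quadratic spaces\<close>

locale finite_quadratic_space =
  fixes Q :: "'a::{field,finite} ^ 'n \<Rightarrow> 'a"
  assumes quadratic_form: "quadratic_form Q"
begin

abbreviation B :: "'a ^ 'n \<Rightarrow> 'a ^ 'n \<Rightarrow> 'a"
  where "B \<equiv> polar_form Q"

lemma Q_scale: "Q (c *s x) = c\<^sup>2 * Q x"
  using quadratic_form by (simp add: quadratic_form_def)

lemma Q_zero: "Q 0 = 0"
  using Q_scale[of 0 0] by simp

lemma Q_add: "Q (x + y) = Q x + Q y + B x y"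
  by (simp add: polar_form_def)

lemma B_commute: "B x y = B y x"
  by (simp add: polar_form_def add.commute)

lemma B_linear_left: "Vector_Spaces.linear (*s) (*) (\<lambda>x. B x y)"
  and B_linear_right: "Vector_Spaces.linear (*s) (*) (\<lambda>y. B x y)"
  using quadratic_form by (simp_all add: quadratic_form_def)

lemma B_simps:
  "B (x + y) z = B x z + B y z" "B x (y + z) = B x y + B x z"
  "B (c *s x) y = c * B x y" "B x (c *s y) = c * B x y"
  "B 0 y = 0" "B x 0 = 0"
  "B (- x) y = - B x y" "B x (- y) = - B x y"
  "B (x - y) z = B x z - B y z" "B x (y - z) = B x y - B x z"
proof -
  interpret l: Vector_Spaces.linear "(*s)" "(*)" "\<lambda>x. B x y" for y by (rule B_linear_left)
  interpret r: Vector_Spaces.linear "(*s)" "(*)" "\<lambda>y. B x y" for x by (rule B_linear_right)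
  show "B (x + y) z = B x z + B y z" "B x (y + z) = B x y + B x z"
    "B (c *s x) y = c * B x y" "B x (c *s y) = c * B x y"
    "B 0 y = 0" "B x 0 = 0"
    "B (- x) y = - B x y" "B x (- y) = - B x y"
    "B (x - y) z = B x z - B y z" "B x (y - z) = B x y - B x z"
    by (rule l.add r.add l.scale r.scale l.zero r.zero l.neg r.neg l.diff r.diff)+
qed

lemma B_self: "B x x = 2 * Q x"
proof -
  have "x + x = 2 *s x" by (simp add: vec_eq_iff)
  then have "Q (x + x) = 4 * Q x" by (simp only: Q_scale) simp
  then show ?thesis by (simp add: polar_form_def algebra_simps)
qed

lemma Q_diff: "Q (x - y) = Q x + Q y - B x y"
  using Q_add[of x "- y"] Q_scale[of "- 1" y] by (simp add: B_simps)

lemma totally_singular_B: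
  assumes "totally_singular Q U" "x \<in> U" "y \<in> U"
  shows "B x y = 0"
  using assms vec.subspace_add[of U x y] by (auto simp: totally_singular_def polar_form_def)

text \<open>The Witt index is only bounded below, so the induction on \<open>n\<close> never has to
  bound it above. The radical of \<open>B\<close> itself must be trivial; this agrees with
  \<open>nondegenerate\<close> when 2 is invertible.\<close>

definition hyperbolic_space :: "nat \<Rightarrow> ('a ^ 'n) set \<Rightarrow> bool"
  where "hyperbolic_space n V \<longleftrightarrow> vec.subspace V \<and> vec.dim V = 2 * n \<and>
    (\<forall>x\<in>V. (\<forall>y\<in>V. B x y = 0) \<longrightarrow> x = 0) \<and>
    (\<exists>U\<subseteq>V. totally_singular Q U \<and> n \<le> vec.dim U)"

section \<open>Hyperbolic pairs and their orthogonal complements\<close>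

definition hyperbolic_pair :: "'a ^ 'n \<Rightarrow> 'a ^ 'n \<Rightarrow> bool"
  where "hyperbolic_pair x y \<longleftrightarrow> Q x = 0 \<and> Q y = 0 \<and> B x y = 1"

definition pair_perp :: "'a ^ 'n \<Rightarrow> 'a ^ 'n \<Rightarrow> ('a ^ 'n) set \<Rightarrow> ('a ^ 'n) set"
  where "pair_perp x y V = {w \<in> V. B w x = 0 \<and> B w y = 0}"

lemma hyperbolic_pair_B:
  assumes "hyperbolic_pair x y"
  shows "Q x = 0" "Q y = 0" "B x y = 1" "B y x = 1" "B x x = 0" "B y y = 0"
  using assms by (auto simp: hyperbolic_pair_def B_commute B_self)

lemma subspace_pair_perp: "vec.subspace V \<Longrightarrow> vec.subspace (pair_perp x y V)"
  unfolding pair_perp_def vec.subspace_def by (auto simp: B_simps)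

lemma pair_perp_subset: "pair_perp x y V \<subseteq> V"
  by (auto simp: pair_perp_def)

lemma hyperbolic_pair_exists:
  assumes V: "hyperbolic_space n V" and x: "x \<in> V" "x \<noteq> 0" "Q x = 0"
  obtains y where "y \<in> V" "hyperbolic_pair x y"
proof -
  have sV: "vec.subspace V" using V by (simp add: hyperbolic_space_def)
  obtain z where z: "z \<in> V" "B x z \<noteq> 0"
    using V x by (auto simp: hyperbolic_space_def)
  define w where "w = (1 / B x z) *s z"
  have w: "w \<in> V" "B x w = 1"
    using z sV by (auto simp: w_def B_simps vec.subspace_scale)
  \<comment> \<open>As \<open>B x w = 1\<close> and \<open>x\<close> is singular, subtracting
    \<open>Q w *s x\<close> changes the value of \<open>Q\<close> by exactly
    \<open>- Q w\<close>.\<close>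
  define y where "y = w - Q w *s x"
  have "y \<in> V" unfolding y_def using w x sV by (intro vec.subspace_diff vec.subspace_scale)
  moreover have "hyperbolic_pair x y"
    using w x by (simp add: hyperbolic_pair_def y_def Q_diff Q_scale B_simps B_self B_commute[of w x])
  ultimately show ?thesis by (rule that)
qed

lemma pair_perp_decomp:
  assumes "vec.subspace V" "x \<in> V" "y \<in> V" "hyperbolic_pair x y" "v \<in> V"
  shows "v - B v y *s x - B v x *s y \<in> pair_perp x y V"
  using assms hyperbolic_pair_B[OF assms(4)]
  by (auto simp: pair_perp_def B_simps intro!: vec.subspace_diff vec.subspace_scale)

lemma span_pair_perp:
  assumes "vec.subspace V" "x \<in> V" "y \<in> V" "hyperbolic_pair x y"
  shows "vec.span (insert x (insert y (pair_perp x y V))) = V"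
proof
  show "vec.span (insert x (insert y (pair_perp x y V))) \<subseteq> V"
    using assms by (intro vec.span_minimal) (auto simp: pair_perp_def)
  show "V \<subseteq> vec.span (insert x (insert y (pair_perp x y V)))"
    using vec.span_base[OF pair_perp_decomp[OF assms]]
    unfolding vec.span_breakdown_eq subset_iff by blast
qed

lemma dim_pair_perp:
  assumes "vec.subspace V" "x \<in> V" "y \<in> V" "hyperbolic_pair x y"
  shows "vec.dim V = vec.dim (pair_perp x y V) + 2"
proof -
  let ?W = "pair_perp x y V"
  note B = hyperbolic_pair_B[OF assms(4)]
  have W: "vec.span ?W = ?W"
    using assms by (simp add: subspace_pair_perp vec.span_eq_iff)
  have y: "y \<notin> vec.span ?W"
    using B unfolding W by (simp add: pair_perp_def)
  have x: "x \<notin> vec.span (insert y ?W)"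
    using B unfolding vec.span_breakdown_eq W by (auto simp: pair_perp_def B_simps)
  have "vec.dim V = vec.dim (insert x (insert y ?W))"
    using span_pair_perp[OF assms] vec.dim_span by metis
  then show ?thesis using x y by (simp add: vec.dim_insert)
qed

text \<open>Splitting off a hyperbolic plane lowers the rank by one: a vector of the complement
  orthogonal to the complement is orthogonal to \<open>V\<close>, and a large totally singular
  subspace is projected along \<open>x\<close> into the complement.\<close>

lemma hyperbolic_space_pair_perp:
  assumes V: "hyperbolic_space (Suc n) V" and xy: "x \<in> V" "y \<in> V" "hyperbolic_pair x y"
  shows "hyperbolic_space n (pair_perp x y V)"
proof -
  let ?W = "pair_perp x y V"
  note B = hyperbolic_pair_B[OF xy(3)]
  have sV: "vec.subspace V" and dV: "vec.dim V = 2 * Suc n"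
    and nV: "\<And>x. x \<in> V \<Longrightarrow> (\<And>y. y \<in> V \<Longrightarrow> B x y = 0) \<Longrightarrow> x = 0"
    using V by (auto simp: hyperbolic_space_def)
  obtain U where U: "U \<subseteq> V" "totally_singular Q U" "Suc n \<le> vec.dim U"
    using V by (auto simp: hyperbolic_space_def)
  have sU: "vec.subspace U" using U by (simp add: totally_singular_def)
  have "w = 0" if w: "w \<in> ?W" "\<And>z. z \<in> ?W \<Longrightarrow> B w z = 0" for w
  proof (rule nV)
    show "w \<in> V" using w by (auto simp: pair_perp_def)
    show "B w v = 0" if v: "v \<in> V" for v
      using w(2)[OF pair_perp_decomp[OF sV xy v]] w(1) by (auto simp: pair_perp_def B_simps)
  qed
  moreover have "\<exists>U'\<subseteq>?W. totally_singular Q U' \<and> n \<le> vec.dim U'"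
  proof -
    define T where "T = {u \<in> U. B u x = 0}"
    have sT: "vec.subspace T" using sU by (auto simp: T_def vec.subspace_def B_simps)
    \<comment> \<open>\<open>S\<close> is the projection of \<open>T\<close> along \<open>x\<close>.
      It stays totally singular because \<open>T\<close> is orthogonal to the singular vector
      \<open>x\<close>.\<close>
    define S where "S = ?W \<inter> vec.span (insert x T)"
    have sS: "vec.subspace S"
      unfolding S_def by (intro vec.subspace_inter subspace_pair_perp sV vec.subspace_span)
    have TS: "T \<subseteq> vec.span (insert x S)"
    proof
      fix u assume u: "u \<in> T"
      have "u \<in> V" using u U by (auto simp: T_def)
      have "u - B u y *s x \<in> ?W"
        using pair_perp_decomp[OF sV xy \<open>u \<in> V\<close>] u by (simp add: T_def)
      then have "u - B u y *s x \<in> S" unfolding S_def using u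
        by (auto intro!: vec.span_diff vec.span_scale intro: vec.span_base)
      then show "u \<in> vec.span (insert x S)"
        by (auto simp: vec.span_breakdown_eq intro: vec.span_base)
    qed
    have dS: "n \<le> vec.dim S"
    \<comment> \<open>Only one dimension may be lost. If \<open>U\<close> is orthogonal to
      \<open>x\<close>, only the projection can lose one; otherwise \<open>T\<close> is a hyperplane
      of \<open>U\<close>, but \<open>x\<close> lies outside \<open>T\<close>, so the projection
      loses nothing.\<close>
    proof (cases "U \<subseteq> T")
      case True
      then have "vec.dim U \<le> vec.dim (insert x S)" using TS
        by (metis subset_trans vec.dim_mono)
      then show ?thesis using U(3) by (auto simp: vec.dim_insert split: if_splits)
    next
      case False
      then obtain u0 where u0: "u0 \<in> U" "B u0 x \<noteq> 0" by (auto simp: T_def)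
      have xT: "x \<notin> vec.span T"
      proof
        assume "x \<in> vec.span T"
        then have "x \<in> U" using sT by (auto simp: T_def vec.span_eq_iff[THEN iffD2])
        then show False using u0 totally_singular_B[OF U(2)] by blast
      qed
      have "U \<subseteq> vec.span (insert u0 T)"
      proof
        fix u assume u: "u \<in> U"
        have "u - (B u x / B u0 x) *s u0 \<in> T"
          using u u0 sU by (auto simp: T_def B_simps vec.subspace_diff vec.subspace_scale)
        then show "u \<in> vec.span (insert u0 T)"
          by (auto simp: vec.span_breakdown_eq intro: vec.span_base)
      qed
      then have "vec.dim U \<le> vec.dim (insert u0 T)" by (rule vec.dim_mono)
      then have 1: "n \<le> vec.dim T" using U(3) by (auto simp: vec.dim_insert split: if_splits)
      have "insert x T \<subseteq> vec.span (insert x S)" using TS by (auto intro: vec.span_base)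
      then have "vec.dim (insert x T) \<le> vec.dim (insert x S)" by (rule vec.dim_mono)
      then show ?thesis using 1 xT by (auto simp: vec.dim_insert split: if_splits)
    qed
    have "Q w = 0" if w: "w \<in> S" for w
    proof -
      obtain a where "w - a *s x \<in> vec.span T"
        using w unfolding S_def Int_iff vec.span_breakdown_eq by blast
      then have u: "w - a *s x \<in> U" "B (w - a *s x) x = 0"
        using sT by (auto simp: T_def vec.span_eq_iff[THEN iffD2])
      have "Q ((w - a *s x) + a *s x) = 0"
        using u U(2) B(1) unfolding Q_add by (simp add: Q_scale B_simps totally_singular_def)
      then show ?thesis by simp
    qed
    then have "totally_singular Q S" using sS by (simp add: totally_singular_def)
    then show ?thesis using dS by (auto simp: S_def)
  qed
  ultimately show ?thesis
    using dim_pair_perp[OF sV xy] dV subspace_pair_perp[OF sV]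
    unfolding hyperbolic_space_def by auto
qed

lemma hyperbolic_space_SucE:
  assumes V: "hyperbolic_space (Suc n) V"
  obtains x y where "x \<in> V" "y \<in> V" "hyperbolic_pair x y" "hyperbolic_space n (pair_perp x y V)"
proof -
  obtain U where U: "U \<subseteq> V" "totally_singular Q U" "Suc n \<le> vec.dim U"
    using V by (auto simp: hyperbolic_space_def)
  have "\<not> U \<subseteq> {0}" using U(3) vec.dim_mono[of U "{}"] by (auto simp del: vec.dim_eq_0)
  then obtain x where "x \<in> U" "x \<noteq> 0" by auto
  then have x: "x \<in> V" "x \<noteq> 0" "Q x = 0" using U by (auto simp: totally_singular_def)
  obtain y where "y \<in> V" "hyperbolic_pair x y" by (rule hyperbolic_pair_exists[OF V x])
  with x(1) hyperbolic_space_pair_perp[OF V] show ?thesis by (intro that[of x y])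
qed

end

subsection \<open>Counting maximal totally singular subspaces\<close>

lemma one_less_card_field: "1 < CARD('a::{field,finite})"
proof -
  have "card {0, 1 :: 'a} \<le> CARD('a)" by (intro card_mono) auto
  then show ?thesis by simp
qed

lemma card_span_insert:
  fixes x :: "'a::{field,finite} ^ 'n"
  assumes "x \<notin> vec.span S"
  shows "card (vec.span (insert x S)) = CARD('a) * card (vec.span S)"
proof -
  have "bij_betw (\<lambda>(a, w). a *s x + w) (UNIV \<times> vec.span S) (vec.span (insert x S))"
    unfolding bij_betw_def
  proof
    show "inj_on (\<lambda>(a, w). a *s x + w) (UNIV \<times> vec.span S)"
    proof (rule inj_onI, clarify)
      fix a w b z assume *: "w \<in> vec.span S" "z \<in> vec.span S" "a *s x + w = b *s x + z"
      then have "(a - b) *s x = z - w" by (simp add: algebra_simps)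
      with * have "(a - b) *s x \<in> vec.span S" by (simp add: vec.span_diff)
      have "a = b"
      proof (rule ccontr)
        assume "a \<noteq> b"
        then have "x = (1 / (a - b)) *s ((a - b) *s x)" unfolding vec.scale_scale by simp
        then show False using assms vec.span_scale[OF \<open>(a - b) *s x \<in> vec.span S\<close>] by metis
      qed
      with * show "a = b \<and> w = z" by simp
    qed
    show "(\<lambda>(a, w). a *s x + w) ` (UNIV \<times> vec.span S) = vec.span (insert x S)"
    proof (intro equalityI subsetI)
      fix v assume "v \<in> vec.span (insert x S)"
      then obtain a where "v - a *s x \<in> vec.span S" unfolding vec.span_breakdown_eq by blast
      then show "v \<in> (\<lambda>(a, w). a *s x + w) ` (UNIV \<times> vec.span S)"
        by (intro image_eqI[of _ _ "(a, v - a *s x)"]) auto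
    next
      fix v assume "v \<in> (\<lambda>(a, w). a *s x + w) ` (UNIV \<times> vec.span S)"
      then obtain a w where "w \<in> vec.span S" "v = a *s x + w" by auto
      then have "v - a *s x \<in> vec.span S" by simp
      then show "v \<in> vec.span (insert x S)" unfolding vec.span_breakdown_eq by blast
    qed
  qed
  then show ?thesis
    by (simp add: bij_betw_same_card[symmetric] card_cartesian_product)
qed

lemma card_subspace:
  fixes V :: "('a::{field,finite} ^ 'n) set"
  assumes "vec.subspace V"
  shows "card V = CARD('a) ^ vec.dim V"
proof -
  have "card (vec.span S) = CARD('a) ^ vec.dim S" for S :: "('a ^ 'n) set"
    using finite[of S]
  proof (induction S)
    case (insert x S)
    show ?case
    proof (cases "x \<in> vec.span S")
      case True
      then show ?thesis using insert by (simp add: vec.span_redundant vec.dim_insert)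
    next
      case False
      then show ?thesis using insert by (simp add: card_span_insert vec.dim_insert)
    qed
  qed simp
  from this[of V] show ?thesis using assms by (simp add: vec.span_eq_iff[THEN iffD2])
qed

context finite_quadratic_space
begin

section \<open>Singular vectors and their number\<close>

definition singular_vectors :: "('a ^ 'n) set \<Rightarrow> ('a ^ 'n) set"
  where "singular_vectors V = {x \<in> V. x \<noteq> 0 \<and> Q x = 0}"

definition maximal_singular :: "nat \<Rightarrow> ('a ^ 'n) set \<Rightarrow> ('a ^ 'n) set set"
  where "maximal_singular n V = {G. G \<subseteq> V \<and> totally_singular Q G \<and> vec.dim G = n}"

text \<open>For a hyperbolic pair, \<open>a * b\<close> is the value of \<open>Q\<close> at
  \<open>a *s x + b *s y\<close>, so this counts the vectors of given value in a hyperbolic plane: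
  two crossing lines for value 0, a hyperbola otherwise.\<close>

lemma card_hyperbolic_line_level:
  "card {(a, b). a * b = (c::'a)} = (if c = 0 then 2 * CARD('a) - 1 else CARD('a) - 1)"
proof (cases "c = 0")
  case True
  have "{(a, b). a * b = c} = (UNIV \<times> {0}) \<union> ({0} \<times> (UNIV - {0}))" (is "_ = ?A \<union> ?B")
    using True by auto
  moreover have "card (?A \<union> ?B) = card ?A + card ?B" by (intro card_Un_disjoint) auto
  ultimately show ?thesis using True
    by (simp add: card_cartesian_product card_Diff_singleton)
next
  case False
  have "bij_betw (\<lambda>a. (a, c / a)) (UNIV - {0}) {(a, b). a * b = c}"
    by (rule bij_betwI[of _ _ _ fst]) (use False in \<open>auto simp: field_simps\<close>)
  then have "card {(a, b). a * b = c} = card (UNIV - {0::'a})"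
    by (simp add: bij_betw_same_card)
  then show ?thesis using False by (simp add: card_Diff_singleton)
qed

text \<open>Write \<open>v = w + (a *s x + b *s y)\<close> with \<open>w\<close> in
  \<open>W\<close>; then \<open>Q v = Q w + a * b\<close>. Every \<open>w\<close> contributes q - 1
  pairs, and a singular \<open>w\<close> another q.\<close>

lemma card_zeros_step:
  assumes V: "vec.subspace V" and xy: "x \<in> V" "y \<in> V" "hyperbolic_pair x y"
  defines "W \<equiv> pair_perp x y V"
  shows "int (card {v \<in> V. Q v = 0}) =
    (int CARD('a) - 1) * int (card W) + int CARD('a) * int (card {w \<in> W. Q w = 0})"
proof -
  note B = hyperbolic_pair_B[OF xy(3)]
  let ?S = "SIGMA w:W. {(a, b). a * b = - Q w}"
  have "bij_betw (\<lambda>(w, a, b). w + (a *s x + b *s y)) ?S {v \<in> V. Q v = 0}"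
  proof (rule bij_betwI[of _ _ _ "\<lambda>v. (v - B v y *s x - B v x *s y, B v y, B v x)"])
    show "(\<lambda>(w, a, b). w + (a *s x + b *s y)) \<in> ?S \<rightarrow> {v \<in> V. Q v = 0}"
      using xy(1,2) V
      by (auto simp: W_def pair_perp_def Q_add Q_scale B_simps B
          mult.commute intro!: vec.subspace_add vec.subspace_scale)
    show "(\<lambda>v. (v - B v y *s x - B v x *s y, B v y, B v x)) \<in> {v \<in> V. Q v = 0} \<rightarrow> ?S"
      using pair_perp_decomp[OF V xy]
      by (auto simp: W_def Q_diff Q_scale B_simps B)
  qed (auto simp: W_def pair_perp_def B_simps B)
  then have "card {v \<in> V. Q v = 0} = card ?S" by (simp add: bij_betw_same_card)
  also have "\<dots> = (\<Sum>w\<in>W. card {(a, b). a * b = - Q w})"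
    by (subst card_SigmaI) auto
  also have "\<dots> = (\<Sum>w\<in>W. if Q w = 0 then 2 * CARD('a) - 1 else CARD('a) - 1)"
    by (simp add: card_hyperbolic_line_level)
  also have "int \<dots> = (\<Sum>w\<in>W. (int CARD('a) - 1) + (if Q w = 0 then int CARD('a) else 0))"
    unfolding int_sum by (intro sum.cong) (auto simp: of_nat_diff Suc_leI)
  also have "\<dots> = (int CARD('a) - 1) * int (card W) + int CARD('a) * int (card {w \<in> W. Q w = 0})"
    by (simp add: sum.distrib sum.If_cases Int_def conj_commute)
  finally show ?thesis .
qed

text \<open>The factor \<open>CARD('a)\<close> on the left avoids the exponent n - 1, which would be
  truncated at \<open>n = 0\<close>.\<close>

lemma card_zeros:
  assumes "hyperbolic_space n V"
  shows "int CARD('a) * int (card {v \<in> V. Q v = 0}) =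
    int CARD('a) ^ (2 * n) + int CARD('a) ^ Suc n - int CARD('a) ^ n"
  using assms
proof (induction n arbitrary: V)
  case 0
  then have "V = {0}" using vec.subspace_0[of V] by (auto simp: hyperbolic_space_def)
  then have "{v \<in> V. Q v = 0} = {0}" by (auto simp: Q_zero)
  then show ?case by simp
next
  case (Suc n)
  obtain x y where xy: "x \<in> V" "y \<in> V" "hyperbolic_pair x y" "hyperbolic_space n (pair_perp x y V)"
    by (rule hyperbolic_space_SucE[OF Suc.prems])
  have V: "vec.subspace V" using Suc.prems by (simp add: hyperbolic_space_def)
  have "card (pair_perp x y V) = CARD('a) ^ (2 * n)"
    using xy(4) by (simp add: hyperbolic_space_def card_subspace)
  then have "int CARD('a) * int (card {v \<in> V. Q v = 0}) =
    int CARD('a) * ((int CARD('a) - 1) * int CARD('a) ^ (2 * n) +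
      (int CARD('a) ^ (2 * n) + int CARD('a) ^ Suc n - int CARD('a) ^ n))"
    unfolding card_zeros_step[OF V xy(1-3)] Suc.IH[OF xy(4), symmetric] by simp
  then show ?case by (simp add: algebra_simps)
qed

lemma card_singular_vectors:
  assumes "hyperbolic_space (Suc n) V"
  shows "card (singular_vectors V) = (CARD('a) ^ Suc n - 1) * (CARD('a) ^ n + 1)"
proof -
  let ?q = "int CARD('a)"
  have "0 \<in> V" using assms by (simp add: hyperbolic_space_def vec.subspace_0)
  moreover have "singular_vectors V = {v \<in> V. Q v = 0} - {0}" by (auto simp: singular_vectors_def)
  ultimately have Z: "int (card {v \<in> V. Q v = 0}) = int (card (singular_vectors V)) + 1"
    by (simp add: Q_zero card_Diff_singleton of_nat_diff Suc_leI card_gt_0_iff exI[of _ 0])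
  have "?q * int (card (singular_vectors V)) = ?q * ((?q ^ Suc n - 1) * (?q ^ n + 1))"
    using card_zeros[OF assms] unfolding Z
    by (simp add: algebra_simps power_add mult_2 mult_2_right)
  then have "int (card (singular_vectors V)) = (?q ^ Suc n - 1) * (?q ^ n + 1)" by simp
  also have "\<dots> = int ((CARD('a) ^ Suc n - 1) * (CARD('a) ^ n + 1))"
    unfolding of_nat_mult by (simp add: of_nat_diff Suc_leI del: power_Suc mult_Suc_right)
  finally show ?thesis by linarith
qed

text \<open>The residue at the point spanned by \<open>x\<close>, with the complement of a
  hyperbolic pair standing in for the quotient of the perp of \<open>x\<close> by \<open>x\<close>.
  The inverse map adjoins \<open>x\<close>.\<close>

lemma bij_betw_Int_pair_perp:
  assumes V: "hyperbolic_space (Suc n) V" and xy: "x \<in> V" "y \<in> V" "hyperbolic_pair x y"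
  shows "bij_betw (\<lambda>G. G \<inter> pair_perp x y V)
    {G \<in> maximal_singular (Suc n) V. x \<in> G} (maximal_singular n (pair_perp x y V))"
proof -
  let ?W = "pair_perp x y V"
  note B = hyperbolic_pair_B[OF xy(3)]
  have sV: "vec.subspace V" using V by (simp add: hyperbolic_space_def)
  have xW: "x \<notin> ?W" using B by (simp add: pair_perp_def)
  have sp: "vec.span (insert x (G \<inter> ?W)) = G" if "G \<in> maximal_singular (Suc n) V" "x \<in> G" for G
  proof
    have G: "vec.subspace G" "totally_singular Q G" "G \<subseteq> V"
      using that by (auto simp: maximal_singular_def totally_singular_def)
    show "vec.span (insert x (G \<inter> ?W)) \<subseteq> G"
      using that G by (intro vec.span_minimal) auto
    show "G \<subseteq> vec.span (insert x (G \<inter> ?W))"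
    proof
      fix g assume g: "g \<in> G"
      have "g - B g y *s x - B g x *s y \<in> ?W"
        using pair_perp_decomp[OF sV xy] g G by auto
      \<comment> \<open>The \<open>y\<close>-component of \<open>g\<close> vanishes, since
        \<open>g\<close> and \<open>x\<close> both lie in the totally singular
        \<open>G\<close>.\<close>
      then have "g - B g y *s x \<in> G \<inter> ?W"
        using totally_singular_B[OF G(2) g that(2)] g that(2) G(1)
        by (auto intro!: vec.subspace_diff vec.subspace_scale)
      then show "g \<in> vec.span (insert x (G \<inter> ?W))"
        unfolding vec.span_breakdown_eq by (blast intro: vec.span_base)
    qed
  qed
  show ?thesis
  proof (rule bij_betwI[of _ _ _ "\<lambda>H. vec.span (insert x H)"])
    show "(\<lambda>G. G \<inter> ?W) \<in> {G \<in> maximal_singular (Suc n) V. x \<in> G} \<rightarrow> maximal_singular n ?W"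
    proof clarify
      fix G assume G: "G \<in> maximal_singular (Suc n) V" "x \<in> G"
      have s: "vec.subspace (G \<inter> ?W)"
        using G by (intro vec.subspace_inter subspace_pair_perp sV)
          (auto simp: maximal_singular_def totally_singular_def)
      have "vec.dim (insert x (G \<inter> ?W)) = Suc n"
        using sp[OF G] G(1) vec.dim_span[of "insert x (G \<inter> ?W)"] by (simp add: maximal_singular_def)
      moreover have "x \<notin> vec.span (G \<inter> ?W)" using xW s by (simp add: vec.span_eq_iff[THEN iffD2])
      ultimately have "vec.dim (G \<inter> ?W) = n" by (simp add: vec.dim_insert)
      then show "G \<inter> ?W \<in> maximal_singular n ?W"
        using s G by (auto simp: maximal_singular_def totally_singular_def)
    qed
    show "vec.span (insert x (G \<inter> ?W)) = G" if "G \<in> {G \<in> maximal_singular (Suc n) V. x \<in> G}" for G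
      using that sp by auto
    have H: "vec.span (insert x H) \<in> maximal_singular (Suc n) V" "vec.span (insert x H) \<inter> ?W = H"
      if H: "H \<in> maximal_singular n ?W" for H
    proof -
      have sH: "vec.subspace H" "totally_singular Q H" "H \<subseteq> ?W" "vec.dim H = n"
        using H by (auto simp: maximal_singular_def totally_singular_def)
      have spH: "vec.span H = H" using sH by (simp add: vec.span_eq_iff[THEN iffD2])
      have "Q g = 0" if g: "g \<in> vec.span (insert x H)" for g
      proof -
        obtain a where a: "g - a *s x \<in> H" using g unfolding vec.span_breakdown_eq spH by blast
        then have "B (g - a *s x) x = 0" "Q (g - a *s x) = 0"
          using sH by (auto simp: pair_perp_def totally_singular_def)
        then have "Q ((g - a *s x) + a *s x) = 0"
          using B(1) unfolding Q_add by (simp add: Q_scale B_simps)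
        then show ?thesis by simp
      qed
      moreover have "vec.span (insert x H) \<subseteq> V"
        using xy sH(3) pair_perp_subset[of x y V] by (intro vec.span_minimal sV) auto
      moreover have "vec.dim (vec.span (insert x H)) = Suc n"
        using xW sH(3,4) by (auto simp: spH vec.dim_insert)
      ultimately show "vec.span (insert x H) \<in> maximal_singular (Suc n) V"
        by (simp add: maximal_singular_def totally_singular_def)
      show "vec.span (insert x H) \<inter> ?W = H"
      proof (intro equalityI subsetI)
        fix g assume g: "g \<in> vec.span (insert x H) \<inter> ?W"
        then obtain a where a: "g - a *s x \<in> H" using vec.span_breakdown_eq spH by blast
        \<comment> \<open>Pairing with \<open>y\<close> reads off the coefficient of
          \<open>x\<close>, which must therefore be 0.\<close>
        then have "B (g - a *s x) y = 0" "B g y = 0" using g sH by (auto simp: pair_perp_def)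
        then have "a = 0" using B by (simp add: B_simps)
        then show "g \<in> H" using a by simp
      qed (use sH in \<open>auto intro: vec.span_base\<close>)
    qed
    show "(\<lambda>H. vec.span (insert x H)) \<in> maximal_singular n ?W \<rightarrow> {G \<in> maximal_singular (Suc n) V. x \<in> G}"
      using H by (auto intro: vec.span_base)
    show "vec.span (insert x H) \<inter> ?W = H" if "H \<in> maximal_singular n ?W" for H
      using H(2)[OF that] .
  qed
qed

text \<open>The recursion comes from counting the pairs of a singular vector and a maximal singular
  subspace containing it.\<close>

lemma card_maximal_singular:
  assumes "hyperbolic_space n V"
  shows "card (maximal_singular n V) = (\<Prod>i<n. CARD('a) ^ i + 1)"
  using assms
proof (induction n arbitrary: V)
  case 0
  then have "V = {0}" using vec.subspace_0[of V] by (auto simp: hyperbolic_space_def)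
  then have "maximal_singular 0 V = {{0}}"
    by (auto simp: maximal_singular_def totally_singular_def Q_zero vec.subspace_0 vec.subspace_single_0
        dest: vec.subspace_0)
  then show ?case by simp
next
  case (Suc n)
  let ?M = "maximal_singular (Suc n) V"
  have V: "vec.subspace V" using Suc.prems by (simp add: hyperbolic_space_def)
  let ?N = "\<Prod>i<n. CARD('a) ^ i + 1"
  have through: "card {G \<in> ?M. x \<in> G} = ?N" if "x \<in> singular_vectors V" for x
  proof -
    have x: "x \<in> V" "x \<noteq> 0" "Q x = 0" using that by (auto simp: singular_vectors_def)
    obtain y where "y \<in> V" "hyperbolic_pair x y" by (rule hyperbolic_pair_exists[OF Suc.prems x])
    then show ?thesis
      using bij_betw_same_card[OF bij_betw_Int_pair_perp[OF Suc.prems x(1)]] Suc.IH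
        hyperbolic_space_pair_perp[OF Suc.prems x(1)] by simp
  qed
  have on: "card {x \<in> singular_vectors V. x \<in> G} = CARD('a) ^ Suc n - 1" if "G \<in> ?M" for G
  proof -
    have G: "vec.subspace G" "vec.dim G = Suc n" "G \<subseteq> V" "\<forall>x\<in>G. Q x = 0"
      using that by (auto simp: maximal_singular_def totally_singular_def)
    have "{x \<in> singular_vectors V. x \<in> G} = G - {0}" using G by (auto simp: singular_vectors_def)
    then show ?thesis using card_subspace[OF G(1)] G by (simp add: vec.subspace_0)
  qed
  have "(\<Sum>G\<in>?M. card {x \<in> singular_vectors V. x \<in> G}) = (\<Sum>x\<in>singular_vectors V. card {G \<in> ?M. x \<in> G})"
    by (rule sum_multicount_gen) auto
  then have "card ?M * (CARD('a) ^ Suc n - 1) = card (singular_vectors V) * ?N"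
    using through on by simp
  also have "\<dots> = ?N * (CARD('a) ^ n + 1) * (CARD('a) ^ Suc n - 1)"
    using card_singular_vectors[OF Suc.prems] by (simp add: algebra_simps)
  finally have "card ?M * (CARD('a) ^ Suc n - 1) = ?N * (CARD('a) ^ n + 1) * (CARD('a) ^ Suc n - 1)" .
  moreover have "CARD('a) ^ Suc n - 1 > 0"
    using one_less_power[of "CARD('a)" "Suc n"] one_less_card_field by simp
  ultimately show ?case by (simp del: power_Suc)
qed

text \<open>For \<open>n = 4\<close> this is the number of generators on a point that normalises the
  parameter.\<close>

lemma card_maximal_singular_through:
  assumes V: "hyperbolic_space (Suc n) V" and x: "x \<in> singular_vectors V"
  shows "card {G \<in> maximal_singular (Suc n) V. x \<in> G} = (\<Prod>i<n. CARD('a) ^ i + 1)"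
proof -
  have x: "x \<in> V" "x \<noteq> 0" "Q x = 0" using x by (auto simp: singular_vectors_def)
  obtain y where y: "y \<in> V" "hyperbolic_pair x y" by (rule hyperbolic_pair_exists[OF V x])
  show ?thesis
    using bij_betw_same_card[OF bij_betw_Int_pair_perp[OF V x(1) y]]
      card_maximal_singular[OF hyperbolic_space_pair_perp[OF V x(1) y]] by simp
qed

end

subsection \<open>Ovoids and Cameron--Liebler sets\<close>

context finite_quadratic_space
begin

text \<open>Splitting off hyperbolic pairs one after another gives the basis in which the ovoid and
  the conic are written down.\<close>

lemma hyperbolic_frame:
  assumes "hyperbolic_space n V"
  shows "\<exists>e f :: nat \<Rightarrow> 'a ^ 'n. \<forall>i<n. e i \<in> V \<and> f i \<in> V \<and> Q (e i) = 0 \<and> Q (f i) = 0 \<and>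
    (\<forall>j<n. B (e i) (e j) = 0 \<and> B (f i) (f j) = 0 \<and> B (e i) (f j) = of_bool (i = j))"
  using assms
proof (induction n arbitrary: V)
  case (Suc n)
  obtain x y where xy: "x \<in> V" "y \<in> V" "hyperbolic_pair x y" "hyperbolic_space n (pair_perp x y V)"
    by (rule hyperbolic_space_SucE[OF Suc.prems])
  note B = hyperbolic_pair_B[OF xy(3)]
  obtain e f where ef: "\<And>i. i < n \<Longrightarrow> e i \<in> pair_perp x y V \<and> f i \<in> pair_perp x y V \<and>
    Q (e i) = 0 \<and> Q (f i) = 0 \<and>
    (\<forall>j<n. B (e i) (e j) = 0 \<and> B (f i) (f j) = 0 \<and> B (e i) (f j) = of_bool (i = j))"
    using Suc.IH[OF xy(4)] by blast
  have perp: "B (e i) x = 0" "B (e i) y = 0" "B (f i) x = 0" "B (f i) y = 0"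
    "B x (e i) = 0" "B y (e i) = 0" "B x (f i) = 0" "B y (f i) = 0" "e i \<in> V" "f i \<in> V"
    if "i < n" for i
    using ef[OF that] by (auto simp: pair_perp_def B_commute)
  show ?case
    by (rule exI[of _ "case_nat x e"], rule exI[of _ "case_nat y f"])
      (use ef perp B xy(1,2) in \<open>auto split: nat.split\<close>)
qed simp

text \<open>Two distinct vectors of \<open>A\<close> in \<open>G\<close> would be orthogonal, so
  \<open>G\<close> contains at most one. Hence a sum of pencils is again a 0/1 function.\<close>

lemma sum_non_orthogonal:
  assumes "\<And>x y. x \<in> A \<Longrightarrow> y \<in> A \<Longrightarrow> x \<noteq> y \<Longrightarrow> B x y \<noteq> 0" and "totally_singular Q G"
  shows "(\<Sum>x\<in>A. of_bool (x \<in> G)) = (of_bool (A \<inter> G \<noteq> {}) :: 'b::semiring_1)"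
proof (cases "A \<inter> G = {}")
  case True
  then show ?thesis by (auto intro!: sum.neutral)
next
  case False
  then obtain x where x: "x \<in> A" "x \<in> G" by auto
  have "y \<in> G \<longleftrightarrow> y = x" if "y \<in> A" for y
    using assms(1)[OF that x(1)] totally_singular_B[OF assms(2) _ x(2)] x by blast
  then have "(\<Sum>y\<in>A. of_bool (y \<in> G)) = (\<Sum>y\<in>A. of_bool (y = x) :: 'b)"
    by (intro sum.cong) auto
  also have "\<dots> = 1" using x by (simp add: of_bool_def if_distrib)
  finally show ?thesis using False by simp
qed

text \<open>The pencils of the vectors of \<open>A\<close> are pairwise disjoint, and their sizes
  already add up to the number of all maximal singular subspaces.\<close>

lemma ovoid_meets_maximal_singular:
  assumes V: "hyperbolic_space (Suc n) V" and A: "A \<subseteq> singular_vectors V" "card A = CARD('a) ^ n + 1"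
    and non_orth: "\<And>x y. x \<in> A \<Longrightarrow> y \<in> A \<Longrightarrow> x \<noteq> y \<Longrightarrow> B x y \<noteq> 0"
    and G: "G \<in> maximal_singular (Suc n) V"
  shows "A \<inter> G \<noteq> {}"
proof -
  let ?M = "maximal_singular (Suc n) V"
  have "card {G \<in> ?M. A \<inter> G \<noteq> {}} = (\<Sum>G\<in>?M. of_bool (A \<inter> G \<noteq> {}))"
    by (simp add: of_bool_def sum.If_cases Int_def)
  also have "\<dots> = (\<Sum>G\<in>?M. \<Sum>x\<in>A. of_bool (x \<in> G))"
    by (intro sum.cong refl sum_non_orthogonal[symmetric] non_orth) (auto simp: maximal_singular_def)
  also have "\<dots> = (\<Sum>x\<in>A. \<Sum>G\<in>?M. of_bool (x \<in> G))"
    by (rule sum.swap)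
  also have "\<dots> = (\<Sum>x\<in>A. card {G \<in> ?M. x \<in> G})"
    by (simp add: of_bool_def sum.If_cases Int_def)
  also have "\<dots> = card ?M"
    using A card_maximal_singular_through[OF V] by (simp add: card_maximal_singular[OF V] subset_iff)
  finally have "{G \<in> ?M. A \<inter> G \<noteq> {}} = ?M" by (intro card_subset_eq) auto
  with G show ?thesis by blast
qed

text \<open>In the residue at \<open>c\<close>, taken as the complement of \<open>c\<close> and a
  multiple of \<open>d\<close>, the set \<open>A\<close> is an ovoid and \<open>G\<close> becomes a
  maximal singular subspace.\<close>

lemma maximal_singular_meets_ovoid_perp:
  assumes V: "hyperbolic_space (Suc (Suc n)) V"
    and A: "A \<subseteq> singular_vectors V" "card A = CARD('a) ^ n + 1"
    and non_orth: "\<And>x y. x \<in> A \<Longrightarrow> y \<in> A \<Longrightarrow> x \<noteq> y \<Longrightarrow> B x y \<noteq> 0"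
    and cd: "c \<in> singular_vectors V" "d \<in> singular_vectors V" "B c d \<noteq> 0"
    and perp: "\<And>x. x \<in> A \<Longrightarrow> B x c = 0 \<and> B x d = 0"
    and G: "G \<in> maximal_singular (Suc (Suc n)) V" "c \<in> G"
  shows "A \<inter> G \<noteq> {}"
proof -
  define y where "y = (1 / B c d) *s d"
  have sV: "vec.subspace V" using V by (simp add: hyperbolic_space_def)
  have c: "c \<in> V" and y: "y \<in> V" "hyperbolic_pair c y"
    using cd sV by (auto simp: singular_vectors_def hyperbolic_pair_def y_def Q_scale B_simps
        vec.subspace_scale)
  have "A \<subseteq> singular_vectors (pair_perp c y V)"
    using A perp by (auto simp: singular_vectors_def pair_perp_def y_def B_simps)
  moreover have "G \<inter> pair_perp c y V \<in> maximal_singular (Suc n) (pair_perp c y V)"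
    using bij_betwE[OF bij_betw_Int_pair_perp[OF V c y]] G by blast
  ultimately have "A \<inter> (G \<inter> pair_perp c y V) \<noteq> {}"
    using hyperbolic_space_pair_perp[OF V c y] A(2) non_orth
    by (intro ovoid_meets_maximal_singular) auto
  then show ?thesis by blast
qed

end

section \<open>From an ovoid and orthogonal points to a Cameron--Liebler set\<close>

lemma sum_fun_apply: "(\<Sum>a\<in>A. f a) x = (\<Sum>a\<in>A. f a x)"
  for f :: "'b \<Rightarrow> 'c \<Rightarrow> 'd::comm_monoid_add"
  by (induction A rule: infinite_finite_induct) auto

text \<open>Points are represented by vectors; non-orthogonal singular vectors span different
  points. Two elements of \<open>C\<close> suffice, so that each has a non-orthogonal partner for
  the passage to the residue.\<close>

lemma cameron_liebler_ovoid_minus_perp: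
  fixes Q :: "'a::{field,finite} ^ 10 \<Rightarrow> 'a"
  assumes quad: "quadratic_form Q"
    and V: "finite_quadratic_space.hyperbolic_space Q 5 UNIV"
    and A: "\<And>x. x \<in> A \<Longrightarrow> x \<noteq> 0 \<and> Q x = 0" "card A = CARD('a) ^ 3 + 1"
      "\<And>x y. x \<in> A \<Longrightarrow> y \<in> A \<Longrightarrow> x \<noteq> y \<Longrightarrow> polar_form Q x y \<noteq> 0"
    and C: "\<And>c. c \<in> C \<Longrightarrow> c \<noteq> 0 \<and> Q c = 0" "card C \<ge> 2"
      "\<And>c d. c \<in> C \<Longrightarrow> d \<in> C \<Longrightarrow> c \<noteq> d \<Longrightarrow> polar_form Q c d \<noteq> 0"
    and perp: "\<And>x c. x \<in> A \<Longrightarrow> c \<in> C \<Longrightarrow> polar_form Q x c = 0"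
  shows "\<exists>L. cameron_liebler Q L \<and> has_parameter L (real (card A) - real (card C))"
proof -
  interpret finite_quadratic_space Q by standard (rule quad)
  define L where "L = {G \<in> generators Q. A \<inter> G \<noteq> {} \<and> C \<inter> G = {}}"
  let ?pen = "\<lambda>x. point_pencil Q (vec.span {x})"
  have gen: "generators Q = maximal_singular 5 UNIV"
    by (simp add: generators_def maximal_singular_def)
  have pen: "?pen x = {G \<in> generators Q. x \<in> G}" for x
    using vec.span_minimal[of "{x}"] vec.span_base[of x "{x}"]
    by (auto simp: point_pencil_def generators_def totally_singular_def)
  have meets: "A \<inter> G \<noteq> {}" if G: "G \<in> generators Q" and c: "c \<in> C" "c \<in> G" for G c
  proof -
    have "C \<noteq> {c}" using C(2) by auto
    then obtain d where d: "d \<in> C" "d \<noteq> c" using c by auto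
    show ?thesis
      by (rule maximal_singular_meets_ovoid_perp[where n = 3 and c = c and d = d and V = UNIV])
        (use V A C perp c d G gen in \<open>auto simp: singular_vectors_def eval_nat_numeral\<close>)
  qed
  \<comment> \<open>Each sum is 0 or 1 at \<open>G\<close>, and by \<open>meets\<close> the second
    is 1 only where the first is.\<close>
  have ind: "(indicator L G :: real) =
      (\<Sum>x\<in>A. indicator (?pen x) G) - (\<Sum>c\<in>C. indicator (?pen c) G)" for G
  proof (cases "G \<in> generators Q")
    case True
    then have "totally_singular Q G" by (simp add: generators_def)
    then have "(\<Sum>x\<in>D. of_bool (x \<in> G)) = (of_bool (D \<inter> G \<noteq> {}) :: real)"
      if "D = A \<or> D = C" for D
      using that A(3) C(3) by (intro sum_non_orthogonal) auto
    from this[of A] this[of C] have "(\<Sum>x\<in>A. indicator (?pen x) G) = (of_bool (A \<inter> G \<noteq> {}) :: real)"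
      "(\<Sum>c\<in>C. indicator (?pen c) G) = (of_bool (C \<inter> G \<noteq> {}) :: real)"
      using True by (simp_all add: pen indicator_def del: sum_of_bool_eq)
    then show ?thesis using True meets[OF True] by (auto simp: L_def indicator_def)
  qed (simp add: L_def pen indicator_def)
  have point: "vec.span {x} \<in> polar_points Q" if "x \<noteq> 0" "Q x = 0" for x
    using that by (auto simp: polar_points_def totally_singular_def Q_scale vec.dim_insert
        vec.span_breakdown_eq)
  have "(indicator L :: _ \<Rightarrow> real) = (\<Sum>x\<in>A. indicator (?pen x)) - (\<Sum>c\<in>C. indicator (?pen c))"
    by (rule ext) (simp add: ind sum_fun_apply)
  also have "\<dots> \<in> fun_vs.span ((\<lambda>P. indicator (point_pencil Q P)) ` polar_points Q)"
    by (intro fun_vs.span_diff fun_vs.span_sum fun_vs.span_base imageI point) (use A C in auto)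
  finally have "cameron_liebler Q L" by (auto simp: cameron_liebler_def L_def)
  moreover have "has_parameter L (real (card A) - real (card C))"
  proof -
    have card_pen: "(\<Sum>G\<in>generators Q. indicator (?pen x) G) =
        2 * (real CARD('a) + 1) * (real CARD('a) ^ 2 + 1) * (real CARD('a) ^ 3 + 1)"
      if "x \<noteq> 0" "Q x = 0" for x
    proof -
      have "(\<Sum>G\<in>generators Q. indicator (?pen x) G) = real (card {G \<in> maximal_singular (Suc 4) UNIV. x \<in> G})"
        by (simp add: pen gen indicator_def of_bool_def sum.If_cases Int_def)
      \<comment> \<open>The factor for \<open>i = 0\<close> is the leading 2.\<close>
      also have "\<dots> = real (\<Prod>i<4. CARD('a) ^ i + 1)"
        using that V by (subst card_maximal_singular_through) (auto simp: singular_vectors_def)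
      also have "\<dots> = 2 * (real CARD('a) + 1) * (real CARD('a) ^ 2 + 1) * (real CARD('a) ^ 3 + 1)"
        by (simp add: eval_nat_numeral lessThan_Suc algebra_simps)
      finally show ?thesis .
    qed
    have "real (card L) = (\<Sum>G\<in>generators Q. indicator L G)"
      by (simp add: L_def indicator_def sum.If_cases Int_def of_bool_def)
    also have "\<dots> = (\<Sum>x\<in>A. \<Sum>G\<in>generators Q. indicator (?pen x) G)
        - (\<Sum>c\<in>C. \<Sum>G\<in>generators Q. indicator (?pen c) G)"
      unfolding ind sum_subtractf by (subst (1 2) sum.swap) (rule refl)
    also have "\<dots> = (real (card A) - real (card C)) *
        (2 * (real CARD('a) + 1) * (real CARD('a) ^ 2 + 1) * (real CARD('a) ^ 3 + 1))"
      using A(1) C(1) by (simp add: card_pen left_diff_distrib)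
    finally show ?thesis unfolding has_parameter_def Let_def by (simp only: mult_ac)
  qed
  ultimately show ?thesis by blast
qed

section \<open>Finite fields and the norm form of a quadratic extension\<close>

lemma of_nat_card_eq_0: "of_nat CARD('a) = (0 :: 'a::{ring_1,finite})"
proof -
  \<comment> \<open>Translation by 1 permutes the ring, so adding 1 to every summand leaves the
    total unchanged.\<close>
  have "(\<Sum>x\<in>(UNIV :: 'a set). x) = (\<Sum>x\<in>(UNIV :: 'a set). x + 1)"
    by (rule sum.reindex_bij_witness[of _ "\<lambda>x. x + 1" "\<lambda>x. x - 1"]) auto
  then show ?thesis by (simp add: sum.distrib)
qed

text \<open>Squaring identifies 1 and -1, so on a finite field it is not injective and hence not
  surjective.\<close>

lemma nonsquare_exists:
  assumes "(2 :: 'a::{field,finite}) \<noteq> 0"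
  obtains n :: "'a::{field,finite}" where "\<And>a. a\<^sup>2 \<noteq> n"
proof -
  have "(1 :: 'a) \<noteq> - 1" using assms by (metis one_add_one add.right_inverse)
  then have "\<not> inj (\<lambda>a :: 'a. a\<^sup>2)" by (metis injD power2_minus)
  then have "\<not> surj (\<lambda>a :: 'a. a\<^sup>2)" using finite_UNIV_surj_inj[of "\<lambda>a :: 'a. a\<^sup>2"] by auto
  then show ?thesis using that by (metis surjI surj_def)
qed

text \<open>The form is the norm of \<open>x + y * sqrt n\<close> from the quadratic extension,
  which vanishes only at 0.\<close>

lemma norm_form_eq_0:
  fixes n x y :: "'a::field"
  assumes "\<And>a. a\<^sup>2 \<noteq> n" "x\<^sup>2 - n * y\<^sup>2 = 0"
  shows "x = 0 \<and> y = 0"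
proof (cases "y = 0")
  case False
  then have "(x / y)\<^sup>2 = n" using assms(2) by (simp add: field_simps)
  then show ?thesis using assms(1) by blast
qed (use assms in simp)

section \<open>Explicit coordinates for the unitary ovoid and the conic\<close>

theorem corollary7p3:
  fixes h q :: nat and Q :: "'a::{field,finite} ^ 10 \<Rightarrow> 'a"
  assumes "h \<ge> 1" and "q = 3 ^ h" and "CARD('a) = q"
    and "quadratic_form Q" and "nondegenerate Q" and "hyperbolic Q"
  shows "\<exists>L. cameron_liebler Q L \<and> has_parameter L (((real q)\<^sup>2 - 1) * real q)"
proof -
  interpret finite_quadratic_space Q by standard (rule assms)
  have three: "(3 :: 'a) = 0"
    using of_nat_card_eq_0[where 'a = 'a] assms by simp
  have two: "(2 :: 'a) \<noteq> 0"
  proof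
    assume "(2 :: 'a) = 0"
    with three have "(3 :: 'a) - 2 = 0" by simp
    then show False by simp
  qed
  \<comment> \<open>In odd characteristic \<open>B\<close> determines \<open>Q\<close>, so only
    \<open>B\<close> is computed below.\<close>
  have Q0: "Q v = 0" if "B v v = 0" for v
    using that two by (simp add: B_self)
  have V: "hyperbolic_space 5 UNIV"
  proof -
    have "x = 0" if "\<And>y. B x y = 0" for x
      using assms(5) that Q0 by (auto simp: nondegenerate_def)
    then show ?thesis using assms(6) by (auto simp: hyperbolic_space_def hyperbolic_def vec.dim_UNIV card_cart_basis)
  qed
  obtain e f where "\<And>i j :: nat. i < 5 \<Longrightarrow> j < 5 \<Longrightarrow>
      B (e i) (e j) = 0 \<and> B (f i) (f j) = 0 \<and> B (e i) (f j) = of_bool (i = j)"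
    using hyperbolic_frame[OF V] by blast
  then have frame: "B (e i) (e j) = 0" "B (f i) (f j) = 0"
      "B (e i) (f j) = of_bool (i = j)" "B (f j) (e i) = of_bool (i = j)"
    if "i < 5" "j < 5" for i j
    using that by (auto simp: B_commute)
  obtain n :: 'a where n: "\<And>a. a\<^sup>2 \<noteq> n" using nonsquare_exists[OF two] by blast
  have n0: "n \<noteq> 0" using n[of 0] by auto
  \<comment> \<open>The orthogonal vectors \<open>e 3 + n *s f 3\<close> and
    \<open>e 3 - n *s f 3\<close> divide a hyperbolic plane between the 7-space and the 3-space. The
    coefficient of \<open>f 4\<close> cancels the value \<open>- n * a\<^sup>2\<close> of
    \<open>Q\<close> on the middle term.\<close>
  define conic where "conic a = e 4 + a *s (e 3 - n *s f 3) + (n * a\<^sup>2) *s f 4" for a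
  text \<open>With \<open>\<omega>\<^sup>2 = n\<close>, \<open>ovoid (x, y, t)\<close> comes from the isotropic vector \<open>(1, b, c)\<close> with
    \<open>b = x + y \<omega>\<close> and \<open>c = b b\<^sup>* + t \<omega>\<close>; the coefficients at \<open>f 1\<close> and \<open>f 2\<close> are
    those of \<open>b c\<^sup>*\<close> up to the factors \<open>- 1\<close> and \<open>n\<close>, and the one at \<open>f 0\<close> is \<open>c c\<^sup>*\<close>.\<close>
  define N where "N x y = x\<^sup>2 - n * y\<^sup>2" for x y
  define ovoid where "ovoid = (\<lambda>(x, y, t). e 0 + x *s e 1 + y *s e 2 + t *s (e 3 + n *s f 3)
      - (x * N x y - n * y * t) *s f 1 + (n * (y * N x y - x * t)) *s f 2
      + ((N x y)\<^sup>2 - n * t\<^sup>2) *s f 0)"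
  have B_conic: "B (conic a) (conic b) = n * (a - b)\<^sup>2" for a b
    by (simp add: conic_def B_simps frame power2_eq_square algebra_simps)
  have B_conic_f: "B (conic a) (f 4) = 1" for a
    by (simp add: conic_def B_simps frame)
  have B_ovoid_f: "B (ovoid p) (f 0) = 1" for p
    by (cases p) (simp add: ovoid_def B_simps frame)
  have perp: "B (ovoid p) (conic a) = 0" "B (ovoid p) (f 4) = 0"
    "B (f 0) (conic a) = 0" for p a
    by (cases p; simp add: ovoid_def conic_def B_simps frame)+
  \<comment> \<open>The right-hand side is the norm of the Hermitian product of the two isotropic
    vectors: its arguments are the coordinates of \<open>c\<close> plus the conjugate of
    \<open>c'\<close> plus \<open>b\<close> times the conjugate of \<open>b'\<close>. The two sides
    differ by a multiple of 3.\<close>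
  have B_ovoid: "B (ovoid (x, y, t)) (ovoid (x', y', t')) =
      N (N x y + N x' y' + x * x' - n * y * y') (t - t' + y * x' - x * y')" for x y t x' y' t'
  proof -
    have "B (ovoid (x, y, t)) (ovoid (x', y', t')) =
      (N x y)\<^sup>2 - n * t\<^sup>2 + (N x' y')\<^sup>2 - n * t'\<^sup>2 + 2 * n * t * t'
      - x * (x' * N x' y' - n * y' * t') - x' * (x * N x y - n * y * t)
      + n * y * (y' * N x' y' - x' * t') + n * y' * (y * N x y - x * t)"
      by (simp add: ovoid_def B_simps frame algebra_simps)
    also have "\<dots> = N (N x y + N x' y' + x * x' - n * y * y') (t - t' + y * x' - x * y')
        + 3 * (n * (x * y' - y * x') * (t' - t) - N x y * N x' y'
          - (N x y + N x' y') * (x * x' - n * y * y'))"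
      unfolding N_def by algebra
    finally show ?thesis by (simp add: three)
  qed
  have N_eq_0: "x = 0 \<and> y = 0" if "N x y = 0" for x y
    using norm_form_eq_0[OF n that[unfolded N_def]] .
  have ovoid_non_orth: "p = p'" if p: "B (ovoid p) (ovoid p') = 0" for p p'
  proof -
    obtain x y t x' y' t' where pp: "p = (x, y, t)" "p' = (x', y', t')" by (cases p, cases p')
    have 1: "N x y + N x' y' + x * x' - n * y * y' = 0" "t - t' + y * x' - x * y' = 0"
      using N_eq_0[OF p[unfolded pp B_ovoid]] by (rule conjunct1, rule conjunct2)
    \<comment> \<open>Modulo 3 the first component is the norm of the difference of the
      \<open>b\<close>-coordinates, so these agree; the second component then gives
      \<open>t = t'\<close>.\<close>
    have "N (x - x') (y - y') =
        (N x y + N x' y' + x * x' - n * y * y') - 3 * (x * x' - n * y * y')"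
      unfolding N_def by algebra
    then have "N (x - x') (y - y') = 0" using 1(1) three by simp
    from N_eq_0[OF this] have "x = x'" "y = y'" by simp_all
    with 1(2) show ?thesis by (simp add: pp)
  qed
  have ovoid_self: "B (ovoid p) (ovoid p) = 0" for p
  proof -
    obtain x y t where p: "p = (x, y, t)" by (cases p)
    have "N x y + N x y + x * x - n * y * y = 3 * N x y" unfolding N_def by algebra
    also have "\<dots> = 0" using three by simp
    finally show ?thesis unfolding p B_ovoid by (simp add: N_def)
  qed
  \<comment> \<open>\<open>f 0\<close> comes from the remaining isotropic point (0, 0, 1), and
    \<open>f 4\<close> is the point at infinity of the conic.\<close>
  define A where "A = insert (f 0) (range ovoid)"
  define C where "C = insert (f 4) (range conic)"
  have B_f: "B (f 0) (ovoid p) = 1" "B (f 4) (conic a) = 1" for p a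
    using B_ovoid_f B_conic_f by (simp_all add: B_commute[of "f _"])
  have "card A = CARD('a) ^ 3 + 1"
  proof -
    have "inj ovoid" by (rule injI, rule ovoid_non_orth) (simp add: ovoid_self)
    moreover have "f 0 \<notin> range ovoid" using B_ovoid_f frame(2)[of 0 0] by auto
    ultimately show ?thesis
      by (simp add: A_def card_image power3_eq_cube mult.assoc)
  qed
  moreover have "card C = CARD('a) + 1"
  proof -
    have "inj conic"
    proof
      fix a b assume "conic a = conic b"
      then show "a = b" using B_conic[of a b] B_conic[of a a] n0 by simp
    qed
    moreover have "f 4 \<notin> range conic" using B_conic_f frame(2)[of 4 4] by auto
    ultimately show ?thesis by (simp add: C_def card_image)
  qed
  moreover have "\<exists>L. cameron_liebler Q L \<and> has_parameter L (real (card A) - real (card C))"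
  proof (rule cameron_liebler_ovoid_minus_perp[OF assms(4) V])
    show "x \<noteq> 0 \<and> Q x = 0" if "x \<in> A" for x
    proof
      \<comment> \<open>A vector whose product with some vector is 1 cannot be 0.\<close>
      have "B x (f 0) = 1 \<or> B (e 0) x = 1" using that B_ovoid_f frame(3)[of 0 0] by (auto simp: A_def)
      then show "x \<noteq> 0" by (auto simp: B_simps)
      show "Q x = 0" using that ovoid_self frame(2)[of 0 0] by (intro Q0) (auto simp: A_def)
    qed
    show "c \<noteq> 0 \<and> Q c = 0" if "c \<in> C" for c
    proof
      have "B c (f 4) = 1 \<or> B (e 4) c = 1" using that B_conic_f frame(3)[of 4 4] by (auto simp: C_def)
      then show "c \<noteq> 0" by (auto simp: B_simps)
      show "Q c = 0" using that B_conic frame(2)[of 4 4] by (intro Q0) (auto simp: C_def)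
    qed
    show "B x y \<noteq> 0" if "x \<in> A" "y \<in> A" "x \<noteq> y" for x y
      using that B_ovoid_f B_f by (auto simp: A_def dest: ovoid_non_orth)
    show "B c d \<noteq> 0" if "c \<in> C" "d \<in> C" "c \<noteq> d" for c d
      using that B_conic n0 B_conic_f B_f by (auto simp: C_def)
    show "B x c = 0" if "x \<in> A" "c \<in> C" for x c
      using that perp frame(2)[of 0 4] by (auto simp: A_def C_def)
  qed (use \<open>card A = _\<close> \<open>card C = _\<close> one_less_card_field in auto)
  ultimately show ?thesis
    using assms(3) by (simp add: algebra_simps power2_eq_square power3_eq_cube)
qed

end
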